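(* Let $n\ge 1$ and let $F$ be the earliest finishing time, regarded as a tropical polynomial in $t_1,\dots,t_n$, of a project network with set of activities $[n]$. Then: (i) $V(F)_{\ge 0}$ is the set of points $\boldsymbol t\in\varGamma$ for which there are two or more critical paths; (ii) all the points in any one connected component of $\varGamma_F$ have the same unique critical path; (iii) every path becomes a critical path for some time costs, i.e. for every path $I$ there is $\boldsymbol t\in\varGamma$ such that $I$ is a critical path at $\boldsymbol t$.
   Context: $[n]=\{1,\dots,n\}$. Tropical (max-plus) arithmetic is used: tropical addition $\oplus$ (also written $\sum$) is $\max$, tropical multiplication is ordinary addition. For $I\subset[n]$, $t_I=\prod_{i\in I}t_i$ denotes the tropical monomial whose value at $\boldsymbol t=(t_1,\dots,t_n)$ is the ordinary sum $\sum_{i\in I}t_i$. A project network (PERT chart) with activity set $[n]$ is a finite simple directed graph (no loops, no multiple arrows) with vertex set $[n]\cup\{u,y\}$ ($u$ the start activity, $y$ the end activity, both of time cost $0$), without directed cycles, such that every vertex is reachable from $u$ and $y$ is reachable from every vertex, and without short-cuts: if there is a directed path $x_0\to x_1\to\cdots\to x_k$ with $k\ge2$, then there is no arrow $x_0\to x_k$. Equivalently, it is the Hasse diagram of a poset structure on $[n]$ to which a minimum $u$ and a maximum $y$ have been added. A path is the set $I\subset[n]$ of activities (omitting $u,y$) on a directed path from $u$ to $y$; equivalently, a maximal totally ordered subset of the poset $[n]$. Let $\mathcal I$ be the set of paths. Activity $i$ has time cost $t_i\ge0$. The earliest finishing time is $F=\sum_{I\in\mathcal I}t_I$ (tropical sum),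 i.e. $F(\boldsymbol t)=\max_{I\in\mathcal I}\sum_{i\in I}t_i$. A critical path at $\boldsymbol t$ is a path $I$ attaining this maximum. $\varGamma=\mathbb R_{\ge0}^n$. The tropical hypersurface $V(F)\subset\mathbb R^n$ is the set of points at which more than one term of $F$ attains the maximum; $V(F)_{\ge0}=V(F)\cap\varGamma$ and $\varGamma_F=\varGamma\setminus V(F)_{\ge0}$. *)

theory Defs
  imports
    "HOL-Analysis.Analysis"
    "HOL-Library.Poly_Mapping"
    "Graph_Theory.Graph_Theory"
begin

section \<open>The max-plus semiring and tropical polynomials\<close>

text \<open>
  The tropical semiring \<open>\<real> \<union> {-\<infinity>}\<close>: addition is the maximum and multiplication is the ordinary
  sum, so the semiring zero is \<open>-\<infinity>\<close> and the semiring one is the real number 0.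
\<close>

datatype maxplus = NegInf | Fin real

instantiation maxplus :: comm_semiring_1
begin

definition zero_maxplus :: maxplus where
  "0 = NegInf"

definition one_maxplus :: maxplus where
  "1 = Fin 0"

fun plus_maxplus :: "maxplus \<Rightarrow> maxplus \<Rightarrow> maxplus" where
  "NegInf + b = b"
| "Fin x + NegInf = Fin x"
| "Fin x + Fin y = Fin (max x y)"

fun times_maxplus :: "maxplus \<Rightarrow> maxplus \<Rightarrow> maxplus" where
  "NegInf * b = NegInf"
| "Fin x * NegInf = NegInf"
| "Fin x * Fin y = Fin (x + y)"

instance
proof
  fix a b c :: maxplus
  show "a + b + c = a + (b + c)"
    by (cases a; cases b; cases c) (auto simp: max.assoc)
  show "a + b = b + a"
    by (cases a; cases b) (auto simp: max.commute)
  show "0 + a = a"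
    by (simp add: zero_maxplus_def)
  show "a * b * c = a * (b * c)"
    by (cases a; cases b; cases c) auto
  show "a * b = b * a"
    by (cases a; cases b) auto
  show "1 * a = a"
    by (cases a) (auto simp: one_maxplus_def)
  show "(a + b) * c = a * c + b * c"
    by (cases a; cases b; cases c) (auto simp: max_def)
  show "0 * a = 0"
    by (simp add: zero_maxplus_def)
  show "a * 0 = 0"
    by (cases a) (auto simp: zero_maxplus_def)
  show "(0::maxplus) \<noteq> 1"
    by (simp add: zero_maxplus_def one_maxplus_def)
qed

end

text \<open>
  Formal polynomials over the tropical semiring in variables indexed by \<open>'n\<close>: finitely supported
  maps from exponent vectors to coefficients. The semiring structure, and hence \<open>\<Sum>\<close> and \<open>\<Prod>\<close> of
  tropical polynomials, is the one of \<^theory>\<open>HOL-Library.Poly_Mapping\<close>.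
\<close>

type_synonym 'n trop_poly = "('n \<Rightarrow>\<^sub>0 nat) \<Rightarrow>\<^sub>0 maxplus"

definition trop_var :: "'n \<Rightarrow> 'n trop_poly" where
  "trop_var i = Poly_Mapping.single (Poly_Mapping.single i 1) 1"

definition trop_term :: "'n::finite trop_poly \<Rightarrow> ('n \<Rightarrow>\<^sub>0 nat) \<Rightarrow> real ^ 'n \<Rightarrow> maxplus" where
  "trop_term F a t = Poly_Mapping.lookup F a * (\<Prod>i\<in>UNIV. Fin (t $ i) ^ Poly_Mapping.lookup a i)"

definition trop_eval :: "'n::finite trop_poly \<Rightarrow> real ^ 'n \<Rightarrow> maxplus" where
  "trop_eval F t = (\<Sum>a\<in>Poly_Mapping.keys F. trop_term F a t)"

text \<open>
  As the sum in \<^const>\<open>trop_eval\<close> is a maximum, the terms attaining the maximum at \<open>t\<close> are those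
  whose value is \<open>trop_eval F t\<close>.
\<close>

definition trop_hypersurface :: "'n::finite trop_poly \<Rightarrow> (real ^ 'n) set" where
  "trop_hypersurface F =
     {t. \<exists>a\<in>Poly_Mapping.keys F. \<exists>b\<in>Poly_Mapping.keys F. a \<noteq> b \<and>
           trop_term F a t = trop_eval F t \<and> trop_term F b t = trop_eval F t}"

section \<open>Project networks\<close>

datatype 'n vertex = Start | End | Act 'n

locale project_network = digraph G
  for G :: "('n::finite vertex, 'b) pre_digraph" +
  assumes verts_UNIV: "verts G = UNIV"
    and no_cycle: "\<not> (\<exists>p. cycle p)"
    and reachable_from_Start: "Start \<rightarrow>\<^sup>*\<^bsub>G\<^esub> x"
    and End_reachable: "x \<rightarrow>\<^sup>*\<^bsub>G\<^esub> End"
    and no_short_cut: "\<lbrakk>apath x p z; length p \<ge> 2\<rbrakk> \<Longrightarrow> \<not> x \<rightarrow>\<^bsub>G\<^esub> z"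

definition network_paths :: "('n vertex, 'b) pre_digraph \<Rightarrow> 'n set set" where
  "network_paths G =
     {{i. Act i \<in> set (pre_digraph.awalk_verts G Start p)} | p. pre_digraph.apath G Start p End}"

text \<open>The earliest finishing time, as a formal tropical polynomial and as a function.\<close>

definition finishing_poly :: "('n::finite vertex, 'b) pre_digraph \<Rightarrow> 'n trop_poly" where
  "finishing_poly G = (\<Sum>I\<in>network_paths G. \<Prod>i\<in>I. trop_var i)"

definition finishing_time :: "('n::finite vertex, 'b) pre_digraph \<Rightarrow> real ^ 'n \<Rightarrow> real" where
  "finishing_time G t = (MAX I\<in>network_paths G. \<Sum>i\<in>I. t $ i)"

definition critical_path :: "('n::finite vertex, 'b) pre_digraph \<Rightarrow> real ^ 'n \<Rightarrow> 'n set \<Rightarrow> bool" where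
  "critical_path G t I \<longleftrightarrow> I \<in> network_paths G \<and> (\<Sum>i\<in>I. t $ i) = finishing_time G t"

definition nonneg_orthant :: "(real ^ 'n) set" where
  "nonneg_orthant = {t. \<forall>i. 0 \<le> t $ i}"

definition hypersurface_nonneg :: "('n::finite vertex, 'b) pre_digraph \<Rightarrow> (real ^ 'n) set" where
  "hypersurface_nonneg G = trop_hypersurface (finishing_poly G) \<inter> nonneg_orthant"

definition orthant_minus_hypersurface :: "('n::finite vertex, 'b) pre_digraph \<Rightarrow> (real ^ 'n) set" where
  "orthant_minus_hypersurface G = nonneg_orthant - hypersurface_nonneg G"

end

theory Submission
  imports Defs
begin

text \<open>
  A path \<open>I\<close> is determined by its squarefree monomial \<open>t\<^sub>I\<close>, so no two terms of the earliest
  finishing time coincide: its support is the set of monomials \<open>t\<^sub>I\<close>, one for each path, and each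
  of them carries the tropical coefficient 1, the real number 0
  (\<open>keys_finishing_poly\<close>, \<open>lookup_finishing_poly\<close>). Here it matters that the sum
  \<open>\<Sum>I. t\<^sub>I\<close> is taken over a set of distinct subsets of the activities. Hence the term of \<open>I\<close> has
  the value \<open>\<Sum>i\<in>I. t $ i\<close>, the polynomial evaluates to the finishing time, and two
  terms attain the maximum exactly when two paths are critical (\<open>trop_hypersurface_finishing_poly\<close>).
  This is (i).

  For (ii), every point has a critical path because the network has a path from the start to
  the end, and off the hypersurface it is unique. The locus where a given path is critical is
  closed, being cut out by finitely many weak linear inequalities. So a
  connected set off the hypersurface is covered by finitely many pairwise disjoint, relatively
  closed loci, and only one of them can be nonempty (\<open>connected_unique_critical_path\<close>).

  For (iii), let the activities of \<open>I\<close> cost 1 and all others cost 0. A path \<open>J\<close> then takes the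
  time \<open>card (I \<inter> J)\<close>, which is largest for \<open>J = I\<close>.
\<close>

section \<open>Evaluation in the max-plus semiring\<close>

lemma sum_Fin_eq_Max:
  assumes "finite A" "A \<noteq> {}"
  shows "(\<Sum>x\<in>A. Fin (f x)) = Fin (MAX x\<in>A. f x)"
  using assms by (induction A rule: finite_ne_induct) simp_all

lemma prod_Fin_eq_sum:
  "(\<Prod>x\<in>A. Fin (f x)) = Fin (\<Sum>x\<in>A. f x)"
  by (induction A rule: infinite_finite_induct) (simp_all add: one_maxplus_def)

lemma Fin_power:
  "Fin x ^ k = Fin (real k * x)"
  by (induction k) (simp_all add: one_maxplus_def distrib_right)

section \<open>The terms of the finishing polynomial\<close>

definition squarefree_exponent :: "'n set \<Rightarrow> 'n \<Rightarrow>\<^sub>0 nat" where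
  "squarefree_exponent I = (\<Sum>i\<in>I. Poly_Mapping.single i 1)"

lemma lookup_squarefree_exponent:
  fixes I :: "'n::finite set"
  shows "Poly_Mapping.lookup (squarefree_exponent I) i = (if i \<in> I then 1 else 0)"
  by (simp add: squarefree_exponent_def lookup_sum lookup_single when_def)

lemma inj_squarefree_exponent:
  "inj (squarefree_exponent :: 'n::finite set \<Rightarrow> _)"
proof (rule injI)
  fix I J :: "'n set"
  assume "squarefree_exponent I = squarefree_exponent J"
  then have "Poly_Mapping.lookup (squarefree_exponent I) i =
      Poly_Mapping.lookup (squarefree_exponent J) i" for i
    by (rule arg_cong)
  then have "i \<in> I \<longleftrightarrow> i \<in> J" for i
    unfolding lookup_squarefree_exponent by (metis zero_neq_one)
  then show "I = J"
    by blast
qed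

lemma prod_trop_var:
  fixes I :: "'n::finite set"
  shows "(\<Prod>i\<in>I. trop_var i) = Poly_Mapping.single (squarefree_exponent I) 1"
proof -
  have "finite I"
    by simp
  then show ?thesis
    by (induction I rule: finite_induct)
      (simp_all add: squarefree_exponent_def trop_var_def mult_single)
qed

text \<open>
  At most one summand contributes to a given exponent, by injectivity of
  \<^const>\<open>squarefree_exponent\<close>.
\<close>

lemma lookup_finishing_poly:
  fixes G :: "('n::finite vertex, 'b) pre_digraph"
  shows "Poly_Mapping.lookup (finishing_poly G) a =
    (if a \<in> squarefree_exponent ` network_paths G then 1 else 0)"
proof -
  have eq: "Poly_Mapping.lookup (finishing_poly G) a =
      (\<Sum>I\<in>network_paths G. if squarefree_exponent I = a then 1 else 0)"
    unfolding finishing_poly_def prod_trop_var lookup_sum lookup_single when_def ..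
  show ?thesis
  proof (cases "a \<in> squarefree_exponent ` network_paths G")
    case True
    then obtain I where I: "I \<in> network_paths G" "a = squarefree_exponent I"
      by blast
    then have "Poly_Mapping.lookup (finishing_poly G) a =
        (\<Sum>J\<in>network_paths G. if J = I then 1 else 0)"
      unfolding eq by (simp only: inj_eq[OF inj_squarefree_exponent])
    also have "\<dots> = 1"
      using I(1) by (subst sum.delta) simp_all
    finally show ?thesis
      using True by (simp only: if_True)
  next
    case False
    then have "Poly_Mapping.lookup (finishing_poly G) a = 0"
      unfolding eq by (intro sum.neutral ballI if_not_P) blast
    with False show ?thesis
      by (simp only: if_False)
  qed
qed

lemma keys_finishing_poly:
  fixes G :: "('n::finite vertex, 'b) pre_digraph"
  shows "Poly_Mapping.keys (finishing_poly G) = squarefree_exponent ` network_paths G"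
  by (rule set_eqI) (simp add: in_keys_iff lookup_finishing_poly)

lemma trop_term_finishing_poly:
  fixes G :: "('n::finite vertex, 'b) pre_digraph"
  assumes "I \<in> network_paths G"
  shows "trop_term (finishing_poly G) (squarefree_exponent I) t = Fin (\<Sum>i\<in>I. t $ i)"
proof -
  have "(\<Sum>i\<in>UNIV. real (Poly_Mapping.lookup (squarefree_exponent I) i) * t $ i) =
      (\<Sum>i\<in>UNIV. if i \<in> I then t $ i else 0)"
    by (intro sum.cong) (simp_all add: lookup_squarefree_exponent)
  also have "\<dots> = (\<Sum>i\<in>I. t $ i)"
    by (simp add: sum.If_cases)
  finally show ?thesis
    using assms
    by (simp add: trop_term_def lookup_finishing_poly Fin_power prod_Fin_eq_sum)
qed

lemma trop_eval_finishing_poly: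
  fixes G :: "('n::finite vertex, 'b) pre_digraph"
  assumes "network_paths G \<noteq> {}"
  shows "trop_eval (finishing_poly G) t = Fin (finishing_time G t)"
proof -
  have "trop_eval (finishing_poly G) t =
      (\<Sum>I\<in>network_paths G. trop_term (finishing_poly G) (squarefree_exponent I) t)"
    unfolding trop_eval_def keys_finishing_poly
    by (rule sum.reindex_cong[OF inj_on_subset[OF inj_squarefree_exponent subset_UNIV] refl refl])
  also have "\<dots> = (\<Sum>I\<in>network_paths G. Fin (\<Sum>i\<in>I. t $ i))"
    by (intro sum.cong refl trop_term_finishing_poly)
  also have "\<dots> = Fin (finishing_time G t)"
    using assms by (simp add: sum_Fin_eq_Max finishing_time_def)
  finally show ?thesis .
qed

lemma trop_hypersurface_finishing_poly:
  fixes G :: "('n::finite vertex, 'b) pre_digraph"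
  shows "trop_hypersurface (finishing_poly G) =
    {t. \<exists>I J. I \<noteq> J \<and> critical_path G t I \<and> critical_path G t J}"
proof -
  have attains: "trop_term (finishing_poly G) (squarefree_exponent I) t =
      trop_eval (finishing_poly G) t \<longleftrightarrow> critical_path G t I" if "I \<in> network_paths G" for I t
  proof -
    have "trop_eval (finishing_poly G) t = Fin (finishing_time G t)"
      using that by (intro trop_eval_finishing_poly) blast
    with that show ?thesis
      by (simp add: trop_term_finishing_poly critical_path_def)
  qed
  have path: "I \<in> network_paths G" if "critical_path G t I" for I t
    using that by (simp add: critical_path_def)
  show ?thesis
    unfolding trop_hypersurface_def keys_finishing_poly
    by (rule Collect_cong) (use attains path in \<open>simp add: inj_eq[OF inj_squarefree_exponent], metis\<close>)
qed

section \<open>Critical paths\<close>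

lemma critical_path_iff_longest:
  fixes G :: "('n::finite vertex, 'b) pre_digraph"
  shows "critical_path G t I \<longleftrightarrow>
    I \<in> network_paths G \<and> (\<forall>J\<in>network_paths G. (\<Sum>i\<in>J. t $ i) \<le> (\<Sum>i\<in>I. t $ i))"
proof -
  have "(\<Sum>i\<in>I. t $ i) = finishing_time G t \<longleftrightarrow>
      (\<forall>J\<in>network_paths G. (\<Sum>i\<in>J. t $ i) \<le> (\<Sum>i\<in>I. t $ i))" if "I \<in> network_paths G"
    unfolding finishing_time_def eq_commute[of "\<Sum>i\<in>I. t $ i"]
    using that by (subst Max_eq_iff) auto
  then show ?thesis
    by (auto simp: critical_path_def)
qed

lemma ex_critical_path:
  fixes G :: "('n::finite vertex, 'b) pre_digraph"
  assumes "network_paths G \<noteq> {}"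
  shows "\<exists>I. critical_path G t I"
proof -
  have "finishing_time G t \<in> (\<lambda>I. \<Sum>i\<in>I. t $ i) ` network_paths G"
    unfolding finishing_time_def using assms by (intro Max_in) auto
  then show ?thesis
    by (auto simp: critical_path_def)
qed

lemma (in project_network) network_paths_nonempty:
  "network_paths G \<noteq> {}"
  using reachable_from_Start[of End] unfolding network_paths_def reachable_apath by blast

lemma closed_critical_locus:
  fixes G :: "('n::finite vertex, 'b) pre_digraph"
  shows "closed {t. critical_path G t I}"
proof (cases "I \<in> network_paths G")
  case True
  then have "{t. critical_path G t I} =
      (\<Inter>J\<in>network_paths G. {t. (\<Sum>i\<in>J. t $ i) \<le> (\<Sum>i\<in>I. t $ i)})"
    by (auto simp: critical_path_iff_longest)
  then show ?thesis
    by (auto intro!: closed_Collect_le continuous_intros)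
next
  case False
  then show ?thesis
    by (simp add: critical_path_def)
qed

text \<open>
  The locus of one path and the union of the loci of the finitely many others are two closed sets
  that cover \<open>C\<close>; uniqueness makes them disjoint on \<open>C\<close>, so they cannot both meet \<open>C\<close>.
\<close>

lemma connected_unique_critical_path:
  fixes G :: "('n::finite vertex, 'b) pre_digraph"
  assumes "Topological_Spaces.connected C"
    and unique: "\<And>t. t \<in> C \<Longrightarrow> \<exists>!I. critical_path G t I"
  shows "\<exists>I. \<forall>t\<in>C. {J. critical_path G t J} = {I}"
proof (cases "C = {}")
  case False
  then obtain s I where s: "s \<in> C" "critical_path G s I"
    using unique by blast
  define A where "A = {t. critical_path G t I}"
  define B where "B = (\<Union>J\<in>- {I}. {t. critical_path G t J})"
  have "closed A" "closed B"
    unfolding A_def B_def by (auto intro!: closed_UN closed_critical_locus)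
  moreover have cover: "C \<subseteq> A \<union> B"
    using unique by (force simp: A_def B_def)
  moreover have "A \<inter> B \<inter> C = {}"
    using unique by (auto simp: A_def B_def)
  moreover have "A \<inter> C \<noteq> {}"
    using s by (auto simp: A_def)
  ultimately have "B \<inter> C = {}"
    using \<open>Topological_Spaces.connected C\<close> unfolding connected_closed by blast
  with cover have "t \<in> A" "t \<notin> B" if "t \<in> C" for t
    using that by blast+
  then have "{J. critical_path G t J} = {I}" if "t \<in> C" for t
    using that by (auto simp: A_def B_def)
  then show ?thesis
    by blast
qed simp

theorem theorem4p3:
  fixes G :: "('n::finite vertex, 'b) pre_digraph"
  assumes "project_network G"
  shows "hypersurface_nonneg G =
           {t \<in> nonneg_orthant. \<exists>I J. I \<noteq> J \<and> critical_path G t I \<and> critical_path G t J}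
       \<and> (\<forall>C\<in>components (orthant_minus_hypersurface G).
             \<exists>I. \<forall>t\<in>C. {J. critical_path G t J} = {I})
       \<and> (\<forall>I\<in>network_paths G. \<exists>t\<in>nonneg_orthant. critical_path G t I)"
proof (intro conjI ballI)
  show hypersurface: "hypersurface_nonneg G =
      {t \<in> nonneg_orthant. \<exists>I J. I \<noteq> J \<and> critical_path G t I \<and> critical_path G t J}"
    unfolding hypersurface_nonneg_def trop_hypersurface_finishing_poly by blast
  show "\<exists>I. \<forall>t\<in>C. {J. critical_path G t J} = {I}"
    if C: "C \<in> components (orthant_minus_hypersurface G)" for C
  proof (rule connected_unique_critical_path)
    show "Topological_Spaces.connected C"
      using C by (rule in_components_connected)
    show "\<exists>!I. critical_path G t I" if "t \<in> C" for t
    proof -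
      have "t \<in> orthant_minus_hypersurface G"
        using C that in_components_subset by blast
      then have "I = J" if "critical_path G t I" "critical_path G t J" for I J
        using that unfolding orthant_minus_hypersurface_def hypersurface by blast
      moreover obtain I where "critical_path G t I"
        using ex_critical_path[OF project_network.network_paths_nonempty[OF assms]] ..
      ultimately show ?thesis
        by (intro ex1I)
    qed
  qed
  show "\<exists>t\<in>nonneg_orthant. critical_path G t I" if I: "I \<in> network_paths G" for I
  proof
    let ?t = "(\<chi> i. if i \<in> I then 1 else 0) :: real ^ 'n"
    show "?t \<in> nonneg_orthant"
      by (simp add: nonneg_orthant_def)
    have time: "(\<Sum>i\<in>J. ?t $ i) = real (card (I \<inter> J))" for J
      by (simp add: sum.If_cases Int_commute)
    show "critical_path G ?t I"
      unfolding critical_path_iff_longest time using I by (auto intro: card_mono)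
  qed
qed

end
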